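(* For every integer $n>4$, $|\operatorname{Av}_n(1\square\underline{23})|<|\operatorname{Av}_n(1\square\underline{32})|$.
   Context: For a pattern $q$, $\operatorname{Av}_n(q)$ is the set of permutations $\pi=\pi_1\cdots\pi_n$ of $[n]$ with no occurrence of $q$. An occurrence of $1\square\underline{23}$ in $\pi$ is a triple of entries $\pi_i,\pi_j,\pi_{j+1}$ with $j\ge i+2$ and $\pi_i<\pi_j<\pi_{j+1}$. An occurrence of $1\square\underline{32}$ is a triple of entries $\pi_i,\pi_j,\pi_{j+1}$ with $j\ge i+2$ and $\pi_i<\pi_{j+1}<\pi_j$. *)

theory Defs
  imports "HOL-Combinatorics.Multiset_Permutations"
begin

text \<open>
  A permutation of \<open>{1..n}\<close> is given in one-line notation as a list of length \<open>n\<close>.  List positions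
  count from 0; the pattern conditions below only compare positions with each other, so
  this shift is harmless.

  A pattern is represented by its occurrence relation: \<open>q p i j\<close> means that the entries of \<open>p\<close>
  at positions \<open>i\<close>, \<open>j\<close> and \<open>j + 1\<close> form an occurrence of \<open>q\<close>.  The box in the patterns stands for
  at least one entry between the first and the second letter; the underlined letters
  must be adjacent.
\<close>

type_synonym pattern = "nat list \<Rightarrow> nat \<Rightarrow> nat \<Rightarrow> bool"

definition pat_1_box_23 :: pattern where
  "pat_1_box_23 p i j \<longleftrightarrow>
     i + 2 \<le> j \<and> j + 1 < length p \<and> p ! i < p ! j \<and> p ! j < p ! (j + 1)"

definition pat_1_box_32 :: pattern where
  "pat_1_box_32 p i j \<longleftrightarrow>
     i + 2 \<le> j \<and> j + 1 < length p \<and> p ! i < p ! (j + 1) \<and> p ! (j + 1) < p ! j"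

definition Av :: "nat \<Rightarrow> pattern \<Rightarrow> nat list set" where
  "Av n q = {p \<in> permutations_of_set {1..n}. \<not> (\<exists>i j. q p i j)}"

end

theory Submission
  imports Defs
begin

text \<open>
  Cut a permutation just before its least entry \<open>m\<close>, as \<open>q @ m # s\<close>.  An occurrence of either
  pattern lies inside \<open>q\<close>, or in the tail of \<open>s\<close> with \<open>m\<close> as its first letter, or it consists of an
  entry of \<open>q\<close> and the first two entries of \<open>s\<close>.  So the avoiders are counted by summing, over the
  set \<open>Q\<close> of entries of \<open>q\<close>, the number of avoiding \<open>q\<close> times the number of admissible \<open>s\<close>, and it
  suffices to compare the latter.  Reversing \<open>s\<close>, or only its tail if some entry of \<open>s\<close> is less than
  all of \<open>Q\<close>, injects the admissible \<open>s\<close> for the first pattern into those for the second.  For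
  \<open>3 \<in> Q \<subseteq> {3, 6, 7, \<dots>}\<close> and \<open>s\<close> a permutation of \<open>{2, 4, 5}\<close> this misses \<open>4 2 5\<close>.
\<close>

text \<open>Asking for the first letter to be below both adjacent letters makes the condition common
  to the two patterns; \<open>R\<close>, taken as \<open>(<)\<close> or \<open>(>)\<close>, carries
  their only difference, the order of the adjacent pair.\<close>

definition avoids :: "(nat \<Rightarrow> nat \<Rightarrow> bool) \<Rightarrow> nat list \<Rightarrow> bool" where
  "avoids R p \<longleftrightarrow> (\<forall>i j. i + 2 \<le> j \<longrightarrow> j + 1 < length p \<longrightarrow> p ! i < p ! j \<longrightarrow> p ! i < p ! (j + 1)
     \<longrightarrow> \<not> R (p ! j) (p ! (j + 1)))"

definition admissible :: "(nat \<Rightarrow> nat \<Rightarrow> bool) \<Rightarrow> nat set \<Rightarrow> nat list \<Rightarrow> bool" where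
  "admissible R Q s \<longleftrightarrow> successively (\<lambda>x y. \<not> R x y) (tl s) \<and>
     (2 \<le> length s \<longrightarrow> R (s ! 0) (s ! 1) \<longrightarrow> \<not> (\<exists>x\<in>Q. x < s ! 0 \<and> x < s ! 1))"

definition avoiders :: "(nat \<Rightarrow> nat \<Rightarrow> bool) \<Rightarrow> nat set \<Rightarrow> nat list set" where
  "avoiders R A = {p \<in> permutations_of_set A. avoids R p}"

definition blocks :: "(nat \<Rightarrow> nat \<Rightarrow> bool) \<Rightarrow> nat set \<Rightarrow> nat set \<Rightarrow> nat list set" where
  "blocks R Q S = {s \<in> permutations_of_set S. admissible R Q s}"

lemma Av_23: "Av n pat_1_box_23 = avoiders (<) {1..n}"
  unfolding Av_def avoiders_def avoids_def pat_1_box_23_def by (intro Collect_cong conj_cong refl) (metis less_trans)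

lemma Av_32: "Av n pat_1_box_32 = avoiders (>) {1..n}"
  unfolding Av_def avoiders_def avoids_def pat_1_box_32_def by (intro Collect_cong conj_cong refl) (metis less_trans)

lemma finite_avoiders [simp]: "finite (avoiders R A)"
  by (simp add: avoiders_def)

lemma finite_blocks [simp]: "finite (blocks R Q S)"
  by (simp add: blocks_def)

text \<open>The least entry \<open>m\<close> cannot be one of the adjacent letters. In the tail of
  \<open>s\<close> it serves as first letter for every adjacent pair, so no \<open>R\<close>-related
  pair survives there. The first pair of \<open>s\<close> is too close to \<open>m\<close>, but
  \<open>m\<close> fills the box between that pair and any entry of \<open>q\<close>; hence the
  order of \<open>q\<close> has no influence on \<open>s\<close>, only \<open>set q\<close>
  has.\<close>

lemma avoids_append_Cons_iff:
  assumes q: "\<forall>x\<in>set q. m < x" and s: "\<forall>x\<in>set s. m < x"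
  shows "avoids R (q @ m # s) \<longleftrightarrow> avoids R q \<and> admissible R (set q) s"
proof
  let ?p = "q @ m # s" and ?k = "length q"
  have ps: "?p ! (?k + Suc t) = s ! t" for t
    by (simp add: nth_append)
  assume av: "avoids R ?p"
  have "avoids R q"
    unfolding avoids_def
  proof (intro allI impI)
    fix i j assume *: "i + 2 \<le> j" "j + 1 < length q" "q ! i < q ! j" "q ! i < q ! (j + 1)"
    then show "\<not> R (q ! j) (q ! (j + 1))"
      using av[unfolded avoids_def, rule_format, of i j] by (simp add: nth_append)
  qed
  moreover have "\<not> R (tl s ! t) (tl s ! Suc t)" if "Suc t < length (tl s)" for t
  proof -
    have "s ! Suc t \<in> set s" "s ! Suc (Suc t) \<in> set s"
      using that by (auto intro!: nth_mem)
    then show ?thesis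
      using av[unfolded avoids_def, rule_format, of ?k "?k + Suc (Suc t)"] that s ps
      by (simp add: nth_tl nth_append)
  qed
  moreover have "\<not> R (s ! 0) (s ! 1)"
    if "2 \<le> length s" "x \<in> set q" "x < s ! 0" "x < s ! 1" for x
  proof -
    obtain i where "i < ?k" "x = q ! i"
      using \<open>x \<in> set q\<close> by (auto simp: in_set_conv_nth)
    then show ?thesis
      using av[unfolded avoids_def, rule_format, of i "?k + 1"] that
      by (simp add: nth_append)
  qed
  ultimately show "avoids R q \<and> admissible R (set q) s"
    unfolding admissible_def successively_conv_nth by blast
next
  let ?p = "q @ m # s" and ?k = "length q"
  assume "avoids R q \<and> admissible R (set q) s"
  then have aq: "avoids R q" and as: "admissible R (set q) s" by auto
  show "avoids R ?p"
    unfolding avoids_def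
  proof (intro allI impI)
    fix i j assume ij: "i + 2 \<le> j" "j + 1 < length ?p" "?p ! i < ?p ! j" "?p ! i < ?p ! (j + 1)"
    have "?p ! i \<in> set ?p" using ij by (intro nth_mem) simp
    then have mi: "m \<le> ?p ! i" using q s by auto
    have "j \<noteq> ?k" "j + 1 \<noteq> ?k" using ij mi by (auto simp: nth_append)
    then consider "j + 1 < ?k" | "j = ?k + 1" | t where "j = ?k + Suc (Suc t)"
    proof -
      \<comment> \<open>If the first two cases fail, \<open>j\<close> is at least
        \<open>?k + 2\<close>, so the truncated subtraction is exact.\<close>
      have "j + 1 < ?k \<or> j = ?k + 1 \<or> j = ?k + Suc (Suc (j - ?k - 2))"
        using \<open>j \<noteq> ?k\<close> \<open>j + 1 \<noteq> ?k\<close> by arith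
      then show thesis using that by blast
    qed
    then show "\<not> R (?p ! j) (?p ! (j + 1))"
    proof cases
      case 1
      then show ?thesis
        using aq[unfolded avoids_def, rule_format, of i j] ij by (simp add: nth_append)
    next
      case 2
      then have "i < ?k" using ij by simp
      then show ?thesis
        using as 2 ij unfolding admissible_def by (auto simp: nth_append)
    next
      case 3
      then have "Suc t < length (tl s)" using ij by simp
      then have "\<not> R (tl s ! t) (tl s ! Suc t)"
        using as unfolding admissible_def successively_conv_nth by blast
      then show ?thesis using 3 ij by (simp add: nth_append nth_tl)
    qed
  qed
qed

text \<open>For fixed \<open>Q\<close> the choices of \<open>q\<close> and \<open>s\<close> are
  independent, whence the product. As \<open>m\<close> lies in neither list, the cut can be read off
  from the whole permutation, so nothing is counted twice.\<close>

lemma card_avoiders_rec: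
  assumes "finite A" "m \<in> A" and m: "\<forall>x\<in>A - {m}. m < x"
  shows "card (avoiders R A) =
    (\<Sum>Q\<in>Pow (A - {m}). card (avoiders R Q) * card (blocks R Q (A - {m} - Q)))"
proof -
  let ?D = "SIGMA Q:Pow (A - {m}). avoiders R Q \<times> blocks R Q (A - {m} - Q)"
  let ?f = "\<lambda>(Q :: nat set, q, s). q @ m # s"
  have "?f ` ?D = avoiders R A"
  proof (intro equalityI subsetI)
    fix p assume "p \<in> ?f ` ?D"
    then obtain Q q s where p: "p = q @ m # s" and "Q \<subseteq> A - {m}"
      and "q \<in> avoiders R Q" "s \<in> blocks R Q (A - {m} - Q)" by auto
    moreover from this have "avoids R p"
      unfolding p using m
      by (subst avoids_append_Cons_iff)
         (auto simp: avoiders_def blocks_def permutations_of_set_def)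
    ultimately show "p \<in> avoiders R A"
      using \<open>m \<in> A\<close> by (auto simp: avoiders_def blocks_def permutations_of_set_def)
  next
    fix p assume p: "p \<in> avoiders R A"
    then obtain q s where qs: "p = q @ m # s"
      using \<open>m \<in> A\<close> by (metis (mono_tags) avoiders_def mem_Collect_eq permutations_of_setD(1) split_list)
    have A: "set p = A" "distinct p" "avoids R p"
      using p by (auto simp: avoiders_def permutations_of_set_def)
    then have sets: "set q \<subseteq> A - {m}" "set s = A - {m} - set q"
      unfolding qs by auto
    then have "avoids R q \<and> admissible R (set q) s"
      using A m unfolding qs by (subst (asm) avoids_append_Cons_iff) auto
    then have "(set q, q, s) \<in> ?D"
      using sets A qs by (auto simp: avoiders_def blocks_def permutations_of_set_def)
    then show "p \<in> ?f ` ?D" unfolding qs by (rule rev_image_eqI) simp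
  qed
  moreover have "card (?f ` ?D) = card ?D"
  proof (intro card_image inj_onI)
    fix u v assume uv: "u \<in> ?D" "v \<in> ?D" "?f u = ?f v"
    obtain Q q s where u: "u = (Q, q, s)" by (cases u)
    obtain Q' q' s' where v: "v = (Q', q', s')" by (cases v)
    have "set q = Q" "set q' = Q'" "m \<notin> set q" "m \<notin> set s"
      using uv unfolding u v by (auto simp: avoiders_def blocks_def permutations_of_set_def)
    moreover have "q @ m # s = q' @ m # s'"
      using uv unfolding u v by simp
    ultimately show "u = v"
      unfolding u v by (auto simp: append_Cons_eq_iff)
  qed
  ultimately have "card (avoiders R A) = card ?D"
    by simp
  then show ?thesis
    using \<open>finite A\<close> by (simp add: card_SigmaI card_cartesian_product)
qed

definition turn_block :: "nat set \<Rightarrow> nat list \<Rightarrow> nat list" where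
  "turn_block Q s =
     (if \<exists>x\<in>Q. \<forall>y\<in>set s. x < y then rev s else take 1 s @ rev (tl s))"

lemma set_turn_block: "set (turn_block Q s) = set s"
  by (cases s) (auto simp: turn_block_def)

lemma distinct_turn_block: "distinct (turn_block Q s) = distinct s"
  by (cases s) (auto simp: turn_block_def)

text \<open>The test in \<open>turn_block\<close> sees \<open>s\<close> only through
  \<open>set s\<close>, so all lists with entry set \<open>S\<close> take the same branch, and each
  branch is invertible.\<close>

lemma inj_on_turn_block: "inj_on (turn_block Q) {s. set s = S}"
proof (rule inj_onI)
  fix s s' assume "s \<in> {s. set s = S}" "s' \<in> {s. set s = S}"
    and "turn_block Q s = turn_block Q s'"
  then show "s = s'"
    by (cases s; cases s') (auto simp: turn_block_def split: if_splits)
qed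

text \<open>If some \<open>x\<close> in \<open>Q\<close> is below all of \<open>s\<close>, the first
  pair of \<open>s\<close> cannot ascend either, so all of \<open>s\<close> descends and its reverse
  has no descent. Otherwise the reversed tail starts with its minimum, and an \<open>x\<close> in
  \<open>Q\<close> below both this and the first entry would be below all of
  \<open>s\<close>.\<close>

lemma admissible_turn_block:
  assumes "admissible (<) Q s"
  shows "admissible (>) Q (turn_block Q s)"
proof (cases s)
  case Nil
  then show ?thesis by (simp add: turn_block_def admissible_def)
next
  case s: (Cons a r)
  have r: "successively (\<ge>) r"
    using assms s by (simp add: admissible_def not_less)
  show ?thesis
  proof (cases "\<exists>x\<in>Q. \<forall>y\<in>set s. x < y")
    case True
    have "successively (\<ge>) s"
    proof (cases r)
      case (Cons b u)
      then have "\<not> a < b"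
        using assms True s unfolding admissible_def by auto
      then show ?thesis using r s Cons by auto
    qed (use s in simp)
    then have "successively (\<le>) (rev s)" by simp
    then show ?thesis
      using True unfolding turn_block_def admissible_def
      \<comment> \<open>This rule separates lists with at least two entries and exposes those
        two.\<close>
      by (cases "rev s" rule: remdups_adj.cases) (auto simp: not_less)
  next
    case False
    then have tb: "turn_block Q s = a # rev r"
      unfolding turn_block_def by (subst if_not_P) (use s in auto)
    have inc: "successively (\<le>) (rev r)" using r by simp
    have "\<not> (\<exists>x\<in>Q. x < a \<and> x < rev r ! 0)" if "1 \<le> length r" "rev r ! 0 < a"
    proof -
      have "rev r ! 0 \<le> y" if "y \<in> set r" for y
      proof -
        have "sorted_wrt (\<le>) (rev r)"
          using inc by (simp add: successively_conv_sorted_wrt sorted_wrt_rev)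
        moreover obtain z zs where "rev r = z # zs"
          using \<open>1 \<le> length r\<close> by (cases "rev r") auto
        moreover have "y \<in> set (rev r)" using that by simp
        ultimately show ?thesis by auto
      qed
      then show ?thesis using False s by (metis less_le_trans set_ConsD)
    qed
    then show ?thesis
      using inc unfolding tb admissible_def by (auto simp: not_less)
  qed
qed

lemma turn_block_blocks: "turn_block Q ` blocks (<) Q S \<subseteq> blocks (>) Q S"
  by (auto simp: blocks_def permutations_of_set_def set_turn_block distinct_turn_block
      admissible_turn_block)

lemma inj_on_turn_block_blocks: "inj_on (turn_block Q) (blocks (<) Q S)"
  by (rule inj_on_subset[OF inj_on_turn_block[of Q S]])
     (auto simp: blocks_def permutations_of_set_def)

lemma card_blocks_le: "card (blocks (<) Q S) \<le> card (blocks (>) Q S)"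
  by (rule card_inj_on_le[OF inj_on_turn_block_blocks turn_block_blocks]) simp

lemma card_blocks_less:
  assumes "3 \<in> Q" "\<forall>x\<in>Q. 3 \<le> x"
  shows "card (blocks (<) Q {2, 4, 5}) < card (blocks (>) Q {2, 4, 5})"
proof -
  have "[4, 2, 5] \<in> blocks (>) Q {2, 4, 5}"
    using assms by (auto simp: blocks_def permutations_of_set_def admissible_def)
  moreover have "[4, 2, 5] \<notin> turn_block Q ` blocks (<) Q {2, 4, 5}"
  proof
    assume "[4, 2, 5] \<in> turn_block Q ` blocks (<) Q {2, 4, 5}"
    then obtain s where s: "s \<in> blocks (<) Q {2, 4, 5}" "turn_block Q s = [4, 2, 5]" by auto
    \<comment> \<open>No element of \<open>Q\<close> is below 2, so only the tail is reversed. By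
      injectivity this is the sole possible preimage, and 3 below the ascent from 4 to 5 excludes
      it.\<close>
    have "turn_block Q [4, 5, 2] = [4, 2, 5]"
      using assms by (auto simp: turn_block_def)
    moreover have "set s = {2, 4, 5}"
      using s by (simp add: blocks_def permutations_of_set_def)
    ultimately have "s = [4, 5, 2]"
      using s(2) by (intro inj_onD[OF inj_on_turn_block[of Q "{2, 4, 5}"], of s "[4, 5, 2]"]) auto
    then show False
      using s assms by (auto simp: blocks_def admissible_def)
  qed
  ultimately have "turn_block Q ` blocks (<) Q {2, 4, 5} \<subset> blocks (>) Q {2, 4, 5}"
    using turn_block_blocks by blast
  then have "card (turn_block Q ` blocks (<) Q {2, 4, 5}) < card (blocks (>) Q {2, 4, 5})"
    by (intro psubset_card_mono) auto
  then show ?thesis by (simp add: card_image[OF inj_on_turn_block_blocks])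
qed

text \<open>Every \<open>Q\<close> in the recurrence at \<open>Min A\<close> is a proper subset of
  \<open>A\<close>, so induction compares the first factors and \<open>card_blocks_le\<close> the
  second. Such \<open>Q\<close> need not be intervals, hence arbitrary finite sets.\<close>

lemma card_avoiders_le:
  assumes "finite A"
  shows "card (avoiders (<) A) \<le> card (avoiders (>) A)"
  using assms
proof (induction rule: finite_psubset_induct)
  case (psubset A)
  show ?case
  proof (cases "A = {}")
    case True
    have "avoiders R {} = {[]}" for R
      by (auto simp: avoiders_def avoids_def)
    then show ?thesis using True by simp
  next
    case False
    have m: "Min A \<in> A" "\<forall>x\<in>A - {Min A}. Min A < x"
      using psubset(1) False by (auto simp: less_le)
    have "card (avoiders (<) Q) \<le> card (avoiders (>) Q)" if "Q \<in> Pow (A - {Min A})" for Q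
      using that m(1) by (intro psubset.IH) auto
    then show ?thesis
      unfolding card_avoiders_rec[OF psubset(1) m]
      by (intro sum_mono mult_mono card_blocks_le) auto
  qed
qed

text \<open>The decreasing arrangement has no ascent. This keeps the factor multiplying a strict
  inequality between blocks positive.\<close>

lemma avoiders_less_nonempty:
  assumes "finite A"
  shows "avoiders (<) A \<noteq> {}"
proof -
  have "avoids (<) (rev (sorted_list_of_set A))"
    unfolding avoids_def
  proof (intro allI impI)
    fix i j assume j: "j + 1 < length (rev (sorted_list_of_set A))"
    have "sorted_wrt (\<ge>) (rev (sorted_list_of_set A))"
      by (simp add: sorted_wrt_rev)
    from sorted_wrt_nth_less[OF this _ j, of j]
    show "\<not> rev (sorted_list_of_set A) ! j < rev (sorted_list_of_set A) ! (j + 1)"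
      by (simp add: not_less)
  qed
  then have "rev (sorted_list_of_set A) \<in> avoiders (<) A"
    using assms by (simp add: avoiders_def permutations_of_set_def)
  then show ?thesis by blast
qed

theorem theorem5p3:
  fixes n :: nat
  assumes "n > 4"
  shows "card (Av n pat_1_box_23) < card (Av n pat_1_box_32)"
proof -
  let ?A = "{1..n}"
  \<comment> \<open>Chosen so that \<open>{2, 4, 5}\<close> is left for the block and 3 is the least
    element of \<open>?Q\<close>; having 5 in \<open>?A\<close> is where \<open>n > 4\<close>
    enters.\<close>
  let ?Q = "?A - {1, 2, 4, 5}"
  have m: "1 \<in> ?A" "\<forall>x\<in>?A - {1}. 1 < x" using assms by auto
  have S: "?A - {1} - ?Q = {2, 4, 5}" using assms by auto
  have "card (blocks (<) ?Q {2, 4, 5}) < card (blocks (>) ?Q {2, 4, 5})"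
    using assms by (intro card_blocks_less) auto
  moreover have "0 < card (avoiders (<) ?Q)"
    using avoiders_less_nonempty[of ?Q] by (simp add: card_gt_0_iff)
  moreover have "card (avoiders (<) ?Q) \<le> card (avoiders (>) ?Q)"
    by (simp add: card_avoiders_le)
  ultimately have strict: "card (avoiders (<) ?Q) * card (blocks (<) ?Q (?A - {1} - ?Q))
      < card (avoiders (>) ?Q) * card (blocks (>) ?Q (?A - {1} - ?Q))"
    unfolding S by (intro mult_le_less_imp_less) auto
  show ?thesis
    unfolding Av_23 Av_32 card_avoiders_rec[OF finite_atLeastAtMost m]
  \<comment> \<open>The sums compare term by term, strictly at \<open>?Q\<close>.\<close>
  proof (rule sum_strict_mono_ex1)
    show "\<forall>Q\<in>Pow (?A - {1}). card (avoiders (<) Q) * card (blocks (<) Q (?A - {1} - Q))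
      \<le> card (avoiders (>) Q) * card (blocks (>) Q (?A - {1} - Q))"
    proof
      fix Q assume "Q \<in> Pow (?A - {1})"
      then have "finite Q" by (auto intro: finite_subset)
      then show "card (avoiders (<) Q) * card (blocks (<) Q (?A - {1} - Q))
        \<le> card (avoiders (>) Q) * card (blocks (>) Q (?A - {1} - Q))"
        by (intro mult_mono card_avoiders_le card_blocks_le) auto
    qed
    have "?Q \<in> Pow (?A - {1})" by auto
    with strict show "\<exists>Q\<in>Pow (?A - {1}). card (avoiders (<) Q) * card (blocks (<) Q (?A - {1} - Q))
      < card (avoiders (>) Q) * card (blocks (>) Q (?A - {1} - Q))" by blast
  qed simp
qed

end
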